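(* Let $\Sigma$ be the first-order theory in the language $\{+,\cdot,0,1,<\}$ axiomatized by A1–A19 (described in the context). Then $\Sigma$ proves the following sentence $\mathbf{GS}^w$: for every prime $p$ there exists an element $n$ such that for every $m$ with $n\le m$ there exists $q$ with $1<q<m$, $q$ and $m$ relatively prime, $u$ and $q$ relatively prime for every prime $u\le p$, and $q$ not prime. (Equivalently: for every prime $p$ there is $n$ such that no $m\ge n$ is $p$-good.)
   Context: Language $\{+,\cdot,0,1,<\}$. Axioms A1–A15 (universal closures; together they form the theory $\mathrm{PA}^-$, whose models are the nonnegative parts of discretely ordered commutative rings): A1 $(x+y)+z=x+(y+z)$; A2 $x+y=y+x$; A3 $(xy)z=x(yz)$; A4 $xy=yx$; A5 $x(y+z)=xy+xz$; A6 $x+0=x\wedge x\cdot 0=0$; A7 $x\cdot1=x$; A8 $x<y\wedge y<z\to x<z$; A9 $\neg x<x$; A10 $x<y\vee x=y\vee y<x$; A11 $x<y\to x+z<y+z$; A12 $0<z\wedge x<y\to xz<yz$; A13 $x<y\to\exists z\,(x+z=y)$; A14 $0<1\wedge(x>0\to x\ge 1)$; A15 $x>0\vee x=0$. Notation: $\bar k$ denotes the numeral $1+1+\dots+1$ ($k$ ones), $\bar0=0$; $x\le y$ means $x<y\vee x=y$; $x\mid y$ means $\exists z\,(xz=y)$; $m,n$ are relatively prime if every common divisor $d$ of $m$ and $n$ equals $1$; $x$ is prime means $1<x$ and for all $a,b,c$, if $xc=ab$ then $x\mid a$ or $x\mid b$. Primes $a<b$ are consecutive if $b\le u$ for every prime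 $u>a$. A16: for every prime $p$ there is a prime $q>p$ with $q\le u$ for every prime $u>p$ (the successor prime $S(p)$). A17: for every prime $p>\bar2$ there is a prime $q<p$ with $u\le q$ for every prime $u<p$ (the predecessor prime $P(p)$). A18: for every $n>\bar4$ there is a prime $p$ with $p^2<n$ such that $n\le q^2$ for every prime $q>p$. A19: for all primes $r<p<q$ with $r,p$ consecutive, $p,q$ consecutive and $\overline{17}<q$, we have $q^2<\bar2pr$. For a prime $p$, an element $n$ is $p$-good if every $t$ with $1<t<n$, $t$ relatively prime to $n$, and $v$ relatively prime to $t$ for every prime $v\le p$, is prime. *)

theory Defs
  imports Main
begin

text \<open>
  Classical first-order logic with equality over the language \<open>{+, \<cdot>, 0, 1, <}\<close>, with de Bruijn
  indices: \<open>Var n\<close> refers to the \<open>n\<close>-th enclosing quantifier, counted from the inside.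
\<close>

datatype tm =
    Var nat
  | Zero
  | One
  | Add tm tm (infixl "\<^bold>+" 65)
  | Mul tm tm (infixl "\<^bold>*" 70)

datatype fm =
    Falsity ("\<^bold>\<bottom>")
  | Eql tm tm (infix "\<^bold>=" 50)
  | Less tm tm (infix "\<^bold><" 50)
  | Imp fm fm (infixr "\<^bold>\<longrightarrow>" 25)
  | All fm ("\<^bold>\<forall>_" [26] 26)

abbreviation Neg :: "fm \<Rightarrow> fm" ("\<^bold>\<not>_" [40] 40)
  where "\<^bold>\<not> A \<equiv> A \<^bold>\<longrightarrow> \<^bold>\<bottom>"

abbreviation Dis :: "fm \<Rightarrow> fm \<Rightarrow> fm" (infixr "\<^bold>\<or>" 30)
  where "A \<^bold>\<or> B \<equiv> \<^bold>\<not> A \<^bold>\<longrightarrow> B"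

abbreviation Con :: "fm \<Rightarrow> fm \<Rightarrow> fm" (infixr "\<^bold>\<and>" 35)
  where "A \<^bold>\<and> B \<equiv> \<^bold>\<not> (A \<^bold>\<longrightarrow> \<^bold>\<not> B)"

abbreviation Exi :: "fm \<Rightarrow> fm" ("\<^bold>\<exists>_" [26] 26)
  where "\<^bold>\<exists> A \<equiv> \<^bold>\<not> (\<^bold>\<forall> (\<^bold>\<not> A))"

primrec subst_tm :: "(nat \<Rightarrow> tm) \<Rightarrow> tm \<Rightarrow> tm" where
  "subst_tm \<sigma> (Var n) = \<sigma> n"
| "subst_tm \<sigma> Zero = Zero"
| "subst_tm \<sigma> One = One"
| "subst_tm \<sigma> (s \<^bold>+ t) = subst_tm \<sigma> s \<^bold>+ subst_tm \<sigma> t"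
| "subst_tm \<sigma> (s \<^bold>* t) = subst_tm \<sigma> s \<^bold>* subst_tm \<sigma> t"

abbreviation lift_tm :: "tm \<Rightarrow> tm" ("\<up>")
  where "\<up> \<equiv> subst_tm (\<lambda>n. Var (Suc n))"

primrec subst_fm :: "(nat \<Rightarrow> tm) \<Rightarrow> fm \<Rightarrow> fm" where
  "subst_fm \<sigma> \<^bold>\<bottom> = \<^bold>\<bottom>"
| "subst_fm \<sigma> (s \<^bold>= t) = (subst_tm \<sigma> s \<^bold>= subst_tm \<sigma> t)"
| "subst_fm \<sigma> (s \<^bold>< t) = (subst_tm \<sigma> s \<^bold>< subst_tm \<sigma> t)"
| "subst_fm \<sigma> (A \<^bold>\<longrightarrow> B) = (subst_fm \<sigma> A \<^bold>\<longrightarrow> subst_fm \<sigma> B)"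
| "subst_fm \<sigma> (\<^bold>\<forall> A) = (\<^bold>\<forall> (subst_fm (case_nat (Var 0) (\<lambda>n. \<up> (\<sigma> n))) A))"

abbreviation lift_fm :: "fm \<Rightarrow> fm"
  where "lift_fm \<equiv> subst_fm (\<lambda>n. Var (Suc n))"

text \<open>\<open>inst_fm t A\<close> is the body \<open>A\<close> of a quantifier with the bound variable replaced by \<open>t\<close>.\<close>

abbreviation inst_fm :: "tm \<Rightarrow> fm \<Rightarrow> fm"
  where "inst_fm t \<equiv> subst_fm (case_nat t Var)"

text \<open>
  Natural deduction. In \<open>AllI\<close> the context is shifted by one, so that the variable being
  generalised does not occur free in it; this is the usual eigenvariable condition.
\<close>

inductive derives :: "fm set \<Rightarrow> fm \<Rightarrow> bool" (infix "\<turnstile>" 20) where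
  Assm: "A \<in> \<Gamma> \<Longrightarrow> \<Gamma> \<turnstile> A"
| ImpI: "insert A \<Gamma> \<turnstile> B \<Longrightarrow> \<Gamma> \<turnstile> A \<^bold>\<longrightarrow> B"
| ImpE: "\<Gamma> \<turnstile> A \<^bold>\<longrightarrow> B \<Longrightarrow> \<Gamma> \<turnstile> A \<Longrightarrow> \<Gamma> \<turnstile> B"
| RAA: "insert (\<^bold>\<not> A) \<Gamma> \<turnstile> \<^bold>\<bottom> \<Longrightarrow> \<Gamma> \<turnstile> A"
| AllI: "lift_fm ` \<Gamma> \<turnstile> A \<Longrightarrow> \<Gamma> \<turnstile> \<^bold>\<forall> A"
| AllE: "\<Gamma> \<turnstile> \<^bold>\<forall> A \<Longrightarrow> \<Gamma> \<turnstile> inst_fm t A"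
| EqlI: "\<Gamma> \<turnstile> t \<^bold>= t"
| EqlE: "\<Gamma> \<turnstile> s \<^bold>= t \<Longrightarrow> \<Gamma> \<turnstile> inst_fm s A \<Longrightarrow> \<Gamma> \<turnstile> inst_fm t A"

text \<open>
  Arithmetical notions. A term argument is lifted once for every quantifier it is placed under.
\<close>

abbreviation Leq :: "tm \<Rightarrow> tm \<Rightarrow> fm" (infix "\<^bold>\<le>" 50)
  where "s \<^bold>\<le> t \<equiv> s \<^bold>< t \<^bold>\<or> s \<^bold>= t"

fun num :: "nat \<Rightarrow> tm" where
  "num 0 = Zero"
| "num (Suc 0) = One"
| "num (Suc (Suc k)) = num (Suc k) \<^bold>+ One"

definition Dvd :: "tm \<Rightarrow> tm \<Rightarrow> fm" where
  "Dvd s t = (\<^bold>\<exists> (\<up> s \<^bold>* Var 0 \<^bold>= \<up> t))"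

definition RelPrime :: "tm \<Rightarrow> tm \<Rightarrow> fm" where
  "RelPrime s t = (\<^bold>\<forall> (Dvd (Var 0) (\<up> s) \<^bold>\<and> Dvd (Var 0) (\<up> t) \<^bold>\<longrightarrow> Var 0 \<^bold>= One))"

definition Prime :: "tm \<Rightarrow> fm" where
  "Prime t = (One \<^bold>< t \<^bold>\<and>
    (let t' = \<up> (\<up> (\<up> t)); a = Var 2; b = Var 1; c = Var 0
     in \<^bold>\<forall> \<^bold>\<forall> \<^bold>\<forall> (t' \<^bold>* c \<^bold>= a \<^bold>* b \<^bold>\<longrightarrow> Dvd t' a \<^bold>\<or> Dvd t' b)))"

text \<open>The primality of \<open>s\<close> and \<open>t\<close> is not part of this formula and is required separately.\<close>

definition Consecutive :: "tm \<Rightarrow> tm \<Rightarrow> fm" where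
  "Consecutive s t = (s \<^bold>< t \<^bold>\<and> (\<^bold>\<forall> (Prime (Var 0) \<^bold>\<and> \<up> s \<^bold>< Var 0 \<^bold>\<longrightarrow> \<up> t \<^bold>\<le> Var 0)))"

definition ax1 :: fm where
  "ax1 = (let x = Var 2; y = Var 1; z = Var 0 in
    \<^bold>\<forall> \<^bold>\<forall> \<^bold>\<forall> ((x \<^bold>+ y) \<^bold>+ z \<^bold>= x \<^bold>+ (y \<^bold>+ z)))"

definition ax2 :: fm where
  "ax2 = (let x = Var 1; y = Var 0 in \<^bold>\<forall> \<^bold>\<forall> (x \<^bold>+ y \<^bold>= y \<^bold>+ x))"

definition ax3 :: fm where
  "ax3 = (let x = Var 2; y = Var 1; z = Var 0 in
    \<^bold>\<forall> \<^bold>\<forall> \<^bold>\<forall> ((x \<^bold>* y) \<^bold>* z \<^bold>= x \<^bold>* (y \<^bold>* z)))"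

definition ax4 :: fm where
  "ax4 = (let x = Var 1; y = Var 0 in \<^bold>\<forall> \<^bold>\<forall> (x \<^bold>* y \<^bold>= y \<^bold>* x))"

definition ax5 :: fm where
  "ax5 = (let x = Var 2; y = Var 1; z = Var 0 in
    \<^bold>\<forall> \<^bold>\<forall> \<^bold>\<forall> (x \<^bold>* (y \<^bold>+ z) \<^bold>= x \<^bold>* y \<^bold>+ x \<^bold>* z))"

definition ax6 :: fm where
  "ax6 = (let x = Var 0 in \<^bold>\<forall> (x \<^bold>+ Zero \<^bold>= x \<^bold>\<and> x \<^bold>* Zero \<^bold>= Zero))"

definition ax7 :: fm where
  "ax7 = (let x = Var 0 in \<^bold>\<forall> (x \<^bold>* One \<^bold>= x))"

definition ax8 :: fm where
  "ax8 = (let x = Var 2; y = Var 1; z = Var 0 in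
    \<^bold>\<forall> \<^bold>\<forall> \<^bold>\<forall> (x \<^bold>< y \<^bold>\<and> y \<^bold>< z \<^bold>\<longrightarrow> x \<^bold>< z))"

definition ax9 :: fm where
  "ax9 = (let x = Var 0 in \<^bold>\<forall> (\<^bold>\<not> (x \<^bold>< x)))"

definition ax10 :: fm where
  "ax10 = (let x = Var 1; y = Var 0 in \<^bold>\<forall> \<^bold>\<forall> (x \<^bold>< y \<^bold>\<or> x \<^bold>= y \<^bold>\<or> y \<^bold>< x))"

definition ax11 :: fm where
  "ax11 = (let x = Var 2; y = Var 1; z = Var 0 in
    \<^bold>\<forall> \<^bold>\<forall> \<^bold>\<forall> (x \<^bold>< y \<^bold>\<longrightarrow> x \<^bold>+ z \<^bold>< y \<^bold>+ z))"

definition ax12 :: fm where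
  "ax12 = (let x = Var 2; y = Var 1; z = Var 0 in
    \<^bold>\<forall> \<^bold>\<forall> \<^bold>\<forall> (Zero \<^bold>< z \<^bold>\<and> x \<^bold>< y \<^bold>\<longrightarrow> x \<^bold>* z \<^bold>< y \<^bold>* z))"

definition ax13 :: fm where
  "ax13 = (\<^bold>\<forall> \<^bold>\<forall> (Var 1 \<^bold>< Var 0 \<^bold>\<longrightarrow>
    (let x = Var 2; y = Var 1; z = Var 0 in \<^bold>\<exists> (x \<^bold>+ z \<^bold>= y))))"

definition ax14 :: fm where
  "ax14 = (let x = Var 0 in \<^bold>\<forall> (Zero \<^bold>< One \<^bold>\<and> (Zero \<^bold>< x \<^bold>\<longrightarrow> One \<^bold>\<le> x)))"

definition ax15 :: fm where
  "ax15 = (let x = Var 0 in \<^bold>\<forall> (Zero \<^bold>< x \<^bold>\<or> x \<^bold>= Zero))"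

definition ax16 :: fm where
  "ax16 = (\<^bold>\<forall> (Prime (Var 0) \<^bold>\<longrightarrow>
    (\<^bold>\<exists> (let p = Var 1; q = Var 0 in Prime q \<^bold>\<and> p \<^bold>< q \<^bold>\<and>
      (\<^bold>\<forall> (let p = Var 2; q = Var 1; u = Var 0 in Prime u \<^bold>\<and> p \<^bold>< u \<^bold>\<longrightarrow> q \<^bold>\<le> u))))))"

definition ax17 :: fm where
  "ax17 = (\<^bold>\<forall> (Prime (Var 0) \<^bold>\<and> num 2 \<^bold>< Var 0 \<^bold>\<longrightarrow>
    (\<^bold>\<exists> (let p = Var 1; q = Var 0 in Prime q \<^bold>\<and> q \<^bold>< p \<^bold>\<and>
      (\<^bold>\<forall> (let p = Var 2; q = Var 1; u = Var 0 in Prime u \<^bold>\<and> u \<^bold>< p \<^bold>\<longrightarrow> u \<^bold>\<le> q))))))"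

definition ax18 :: fm where
  "ax18 = (\<^bold>\<forall> (num 4 \<^bold>< Var 0 \<^bold>\<longrightarrow>
    (\<^bold>\<exists> (let n = Var 1; p = Var 0 in Prime p \<^bold>\<and> p \<^bold>* p \<^bold>< n \<^bold>\<and>
      (\<^bold>\<forall> (let n = Var 2; p = Var 1; q = Var 0 in Prime q \<^bold>\<and> p \<^bold>< q \<^bold>\<longrightarrow> n \<^bold>\<le> q \<^bold>* q))))))"

definition ax19 :: fm where
  "ax19 = (let r = Var 2; p = Var 1; q = Var 0 in
    \<^bold>\<forall> \<^bold>\<forall> \<^bold>\<forall> (Prime r \<^bold>\<and> Prime p \<^bold>\<and> Prime q \<^bold>\<and> Consecutive r p \<^bold>\<and> Consecutive p q \<^bold>\<and> num 17 \<^bold>< q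
      \<^bold>\<longrightarrow> q \<^bold>* q \<^bold>< num 2 \<^bold>* p \<^bold>* r))"

definition Sigma_theory :: "fm set" where
  "Sigma_theory = {ax1, ax2, ax3, ax4, ax5, ax6, ax7, ax8, ax9, ax10, ax11, ax12, ax13, ax14, ax15,
    ax16, ax17, ax18, ax19}"

definition GSw :: fm where
  "GSw = (\<^bold>\<forall> (Prime (Var 0) \<^bold>\<longrightarrow>
    (\<^bold>\<exists> \<^bold>\<forall> (let n = Var 1; m = Var 0 in n \<^bold>\<le> m \<^bold>\<longrightarrow>
      (\<^bold>\<exists> (let m = Var 1; q = Var 0 in One \<^bold>< q \<^bold>\<and> q \<^bold>< m \<^bold>\<and> RelPrime q m \<^bold>\<and>
        (\<^bold>\<forall> (let p = Var 4; q = Var 1; u = Var 0 in Prime u \<^bold>\<and> u \<^bold>\<le> p \<^bold>\<longrightarrow> RelPrime u q)) \<^bold>\<and>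
        \<^bold>\<not> Prime q))))))"

end

(*
  By the completeness theorem it suffices to argue in a model of Sigma, and since every such model
  is infinite and the language is countable, the model may be taken to live on nat: quotient the
  terms by provable equality in a Henkin extension of Sigma together with the negation of GSw, and
  enumerate the classes.

  In the model, let s be the largest prime with s^2 < m and t < r < s < q consecutive primes, so
  that m <= q^2 < 2sr by A18 and A19. If s and r both divide m then m = sr, which t does not
  divide; hence the square of one of s, r, t is coprime to m. It is not prime, and once m is large
  compared with p all three primes exceed p.
*)

theory Submission
  imports Defs "HOL-Library.Countable_Set"
begin

section \<open>Substitution\<close>

lemma subst_tm_comp [simp]:
  "subst_tm \<sigma> (subst_tm \<tau> t) = subst_tm (\<lambda>n. subst_tm \<sigma> (\<tau> n)) t"
  by (induction t) auto

lemma subst_tm_Var [simp]: "subst_tm Var t = t"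
  by (induction t) auto

lemma subst_fm_comp: "subst_fm \<sigma> (subst_fm \<tau> A) = subst_fm (\<lambda>n. subst_tm \<sigma> (\<tau> n)) A"
proof (induction A arbitrary: \<sigma> \<tau>)
  case (All A)
  have "(\<lambda>n. subst_tm (case_nat (Var 0) (\<lambda>n. \<up> (\<sigma> n))) (case_nat (Var 0) (\<lambda>n. \<up> (\<tau> n)) n))
      = case_nat (Var 0) (\<lambda>n. \<up> (subst_tm \<sigma> (\<tau> n)))"
    by (auto split: nat.split)
  then show ?case by (simp add: All)
qed auto

lemma subst_fm_Var [simp]: "subst_fm Var A = A"
proof (induction A)
  case (All A)
  have "case_nat (Var 0) (\<lambda>n. \<up> (Var n)) = Var" by (auto split: nat.split)
  then show ?case using All by simp
qed auto

text \<open>The lifts that \<open>\<sigma>\<close> acquires under the binder are undone by the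
  instantiation, so the two substitutions merge into one. This matches the quantifier clause of
  satisfaction in the term model.\<close>

lemma inst_subst_fm:
  "inst_fm t (subst_fm (case_nat (Var 0) (\<lambda>n. \<up> (\<sigma> n))) A) = subst_fm (case_nat t \<sigma>) A"
proof -
  have "(\<lambda>n. subst_tm (case_nat t Var) (case_nat (Var 0) (\<lambda>n. \<up> (\<sigma> n)) n)) = case_nat t \<sigma>"
    by (auto split: nat.split)
  then show ?thesis by (simp add: subst_fm_comp)
qed

lemma subst_inst_fm:
  "subst_fm \<sigma> (inst_fm t A)
   = inst_fm (subst_tm \<sigma> t) (subst_fm (case_nat (Var 0) (\<lambda>n. \<up> (\<sigma> n))) A)"
proof -
  have "(\<lambda>n. subst_tm \<sigma> (case_nat t Var n)) = case_nat (subst_tm \<sigma> t) \<sigma>"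
    by (auto split: nat.split)
  then show ?thesis by (simp add: inst_subst_fm subst_fm_comp[of _ "case_nat t Var"])
qed

text \<open>Expresses that all free variables have index below \<open>N\<close> through the effect
  of substitutions, without a function collecting the free variables.\<close>

definition bounded_fm :: "nat \<Rightarrow> fm \<Rightarrow> bool" where
  "bounded_fm N A \<longleftrightarrow> (\<forall>\<sigma> \<tau>. (\<forall>n<N. \<sigma> n = \<tau> n) \<longrightarrow> subst_fm \<sigma> A = subst_fm \<tau> A)"

lemma bounded_fmD:
  "bounded_fm N A \<Longrightarrow> (\<And>n. n < N \<Longrightarrow> \<sigma> n = \<tau> n) \<Longrightarrow> subst_fm \<sigma> A = subst_fm \<tau> A"
  unfolding bounded_fm_def by blast

lemma bounded_fm_mono: "bounded_fm M A \<Longrightarrow> M \<le> N \<Longrightarrow> bounded_fm N A"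
  unfolding bounded_fm_def by (meson less_le_trans)

lemma bounded_tm_ex: "\<exists>N. \<forall>\<sigma> \<tau>. (\<forall>n<N. \<sigma> n = \<tau> n) \<longrightarrow> subst_tm \<sigma> t = subst_tm \<tau> t"
proof (induction t)
  case (Add s t)
  then obtain M N where "\<forall>\<sigma> \<tau>. (\<forall>n<M. \<sigma> n = \<tau> n) \<longrightarrow> subst_tm \<sigma> s = subst_tm \<tau> s"
    "\<forall>\<sigma> \<tau>. (\<forall>n<N. \<sigma> n = \<tau> n) \<longrightarrow> subst_tm \<sigma> t = subst_tm \<tau> t" by blast
  then show ?case by (intro exI[of _ "max M N"]) (simp add: less_max_iff_disj)
next
  case (Mul s t)
  then obtain M N where "\<forall>\<sigma> \<tau>. (\<forall>n<M. \<sigma> n = \<tau> n) \<longrightarrow> subst_tm \<sigma> s = subst_tm \<tau> s"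
    "\<forall>\<sigma> \<tau>. (\<forall>n<N. \<sigma> n = \<tau> n) \<longrightarrow> subst_tm \<sigma> t = subst_tm \<tau> t" by blast
  then show ?case by (intro exI[of _ "max M N"]) (simp add: less_max_iff_disj)
qed auto

lemma bounded_fm_ex: "\<exists>N. bounded_fm N A"
proof (induction A)
  case (Eql s t)
  obtain M N where "\<forall>\<sigma> \<tau>. (\<forall>n<M. \<sigma> n = \<tau> n) \<longrightarrow> subst_tm \<sigma> s = subst_tm \<tau> s"
    "\<forall>\<sigma> \<tau>. (\<forall>n<N. \<sigma> n = \<tau> n) \<longrightarrow> subst_tm \<sigma> t = subst_tm \<tau> t"
    using bounded_tm_ex by metis
  then show ?case unfolding bounded_fm_def
    by (intro exI[of _ "max M N"]) (simp add: less_max_iff_disj)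
next
  case (Less s t)
  obtain M N where "\<forall>\<sigma> \<tau>. (\<forall>n<M. \<sigma> n = \<tau> n) \<longrightarrow> subst_tm \<sigma> s = subst_tm \<tau> s"
    "\<forall>\<sigma> \<tau>. (\<forall>n<N. \<sigma> n = \<tau> n) \<longrightarrow> subst_tm \<sigma> t = subst_tm \<tau> t"
    using bounded_tm_ex by metis
  then show ?case unfolding bounded_fm_def
    by (intro exI[of _ "max M N"]) (simp add: less_max_iff_disj)
next
  case (Imp A B)
  then obtain M N where "bounded_fm M A" "bounded_fm N B" by blast
  then have "bounded_fm (max M N) A" "bounded_fm (max M N) B"
    by (auto elim: bounded_fm_mono)
  then show ?case unfolding bounded_fm_def by (metis subst_fm.simps(4))
next
  case (All A)
  then obtain N where N: "bounded_fm N A" by blast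
  have "subst_fm \<sigma> (\<^bold>\<forall> A) = subst_fm \<tau> (\<^bold>\<forall> A)" if "\<forall>n<N. \<sigma> n = \<tau> n" for \<sigma> \<tau>
  proof -
    \<comment> \<open>Under the binder index \<open>Suc n\<close> consults the outer substitutions
      at \<open>n\<close>, so a bound for the body also serves for the quantified formula.\<close>
    have "\<forall>n<N. case_nat (Var 0) (\<lambda>n. \<up> (\<sigma> n)) n = case_nat (Var 0) (\<lambda>n. \<up> (\<tau> n)) n"
      using that by (simp split: nat.split)
    then show ?thesis using N unfolding bounded_fm_def subst_fm.simps by blast
  qed
  then show ?case unfolding bounded_fm_def by blast
qed (auto simp: bounded_fm_def)

lemma bounded_fm_finite: "finite F \<Longrightarrow> \<exists>N. \<forall>A\<in>F. bounded_fm N A"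
proof (induction F rule: finite_induct)
  case (insert A F)
  obtain M where M: "bounded_fm M A" using bounded_fm_ex by blast
  obtain N where "\<forall>B\<in>F. bounded_fm N B" using insert by blast
  then show ?case using M
    by (intro exI[of _ "max M N"]) (auto intro: bounded_fm_mono[of N] bounded_fm_mono[of M])
qed simp

section \<open>Derivability\<close>

lemma derives_weaken: "\<Gamma> \<turnstile> A \<Longrightarrow> \<Gamma> \<subseteq> \<Delta> \<Longrightarrow> \<Delta> \<turnstile> A"
proof (induction arbitrary: \<Delta> rule: derives.induct)
  case (ImpI A \<Gamma> B)
  then show ?case by (meson derives.ImpI insert_mono)
next
  case (RAA A \<Gamma>)
  then show ?case by (meson derives.RAA insert_mono)
next
  case (AllI \<Gamma> A)
  then show ?case by (auto intro!: derives.AllI)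
next
  case (EqlE \<Gamma> s t A)
  then show ?case by (meson derives.EqlE[of \<Delta> s t A])
qed (auto intro: derives.intros)

lemma derives_finite: "\<Gamma> \<turnstile> A \<Longrightarrow> \<exists>F. finite F \<and> F \<subseteq> \<Gamma> \<and> (F \<turnstile> A)"
proof (induction rule: derives.induct)
  case (Assm A \<Gamma>)
  then show ?case by (intro exI[of _ "{A}"]) (auto intro: derives.Assm)
next
  case (ImpI A \<Gamma> B)
  then obtain F where F: "finite F" "F \<subseteq> insert A \<Gamma>" "F \<turnstile> B" by blast
  have "F - {A} \<turnstile> A \<^bold>\<longrightarrow> B"
    using F(2) by (intro derives.ImpI derives_weaken[OF F(3)]) auto
  then show ?case using F by (intro exI[of _ "F - {A}"]) auto
next
  case (ImpE \<Gamma> A B)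
  then obtain F G where "finite F" "F \<subseteq> \<Gamma>" "F \<turnstile> A \<^bold>\<longrightarrow> B" "finite G" "G \<subseteq> \<Gamma>" "G \<turnstile> A" by blast
  then show ?case
    by (intro exI[of _ "F \<union> G"]) (auto intro!: derives.ImpE[of _ A B] elim: derives_weaken)
next
  case (RAA A \<Gamma>)
  then obtain F where F: "finite F" "F \<subseteq> insert (\<^bold>\<not> A) \<Gamma>" "F \<turnstile> \<^bold>\<bottom>" by blast
  have "F - {\<^bold>\<not> A} \<turnstile> A"
    using F(2) by (intro derives.RAA[of A] derives_weaken[OF F(3)]) auto
  then show ?case using F by (intro exI[of _ "F - {\<^bold>\<not> A}"]) auto
next
  case (AllI \<Gamma> A)
  \<comment> \<open>A finite subset of the lifted context is the lift of a finite subset of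
    \<open>\<Gamma>\<close>.\<close>
  then show ?case by (metis derives.AllI finite_subset_image)
next
  case (EqlE \<Gamma> s t A)
  then obtain F G where "finite F" "F \<subseteq> \<Gamma>" "F \<turnstile> s \<^bold>= t" "finite G" "G \<subseteq> \<Gamma>" "G \<turnstile> inst_fm s A"
    by blast
  then show ?case
    by (intro exI[of _ "F \<union> G"]) (auto intro!: derives.EqlE[of _ s t A] elim: derives_weaken)
qed (auto intro: derives.intros)

lemma derives_subst: "\<Gamma> \<turnstile> A \<Longrightarrow> subst_fm \<sigma> ` \<Gamma> \<turnstile> subst_fm \<sigma> A"
proof (induction arbitrary: \<sigma> rule: derives.induct)
  case (ImpE \<Gamma> A B)
  then show ?case by (metis derives.ImpE subst_fm.simps(4))
next
  case (AllI \<Gamma> A)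
  let ?\<sigma> = "case_nat (Var 0) (\<lambda>n. \<up> (\<sigma> n))"
  \<comment> \<open>Lifting and then substituting under the binder equals substituting by
    \<open>\<sigma>\<close> and then lifting, so the context keeps the shape that
    \<open>AllI\<close> demands.\<close>
  have "subst_fm ?\<sigma> ` lift_fm ` \<Gamma> = lift_fm ` subst_fm \<sigma> ` \<Gamma>"
    by (simp add: image_image subst_fm_comp)
  then show ?case using AllI(2)[of ?\<sigma>] by (simp add: derives.AllI)
next
  case (AllE \<Gamma> A t)
  then show ?case by (metis derives.AllE subst_fm.simps(5) subst_inst_fm)
next
  case (EqlE \<Gamma> s t A)
  then show ?case by (metis derives.EqlE subst_fm.simps(2) subst_inst_fm)
qed (auto intro: derives.intros)

lemma derives_cut: "\<Gamma> \<turnstile> A \<Longrightarrow> insert A \<Gamma> \<turnstile> B \<Longrightarrow> \<Gamma> \<turnstile> B"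
  by (meson ImpE ImpI)

lemma derives_contradiction: "\<Gamma> \<turnstile> A \<Longrightarrow> (\<^bold>\<not> A) \<in> \<Gamma> \<Longrightarrow> \<Gamma> \<turnstile> \<^bold>\<bottom>"
  using ImpE Assm by blast

text \<open>The eigenvariable rule for a named fresh variable \<open>x\<close>: a renaming turns
  \<open>x\<close> into the variable to be bound and brings the context into the lifted form of
  \<open>AllI\<close>.\<close>

lemma derives_generalise:
  assumes "\<Gamma> \<turnstile> inst_fm (Var x) A" "\<forall>B\<in>\<Gamma>. bounded_fm x B" "bounded_fm x A"
  shows "\<Gamma> \<turnstile> \<^bold>\<forall> A"
proof -
  \<comment> \<open>On formulas with variables below \<open>x\<close> this is lifting; on the
    instance of \<open>A\<close> at \<open>x\<close> it undoes the instantiation.\<close>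
  define \<sigma> where "\<sigma> = (\<lambda>n. if n = x then Var 0 else Var (Suc n))"
  have "subst_fm \<sigma> ` \<Gamma> = lift_fm ` \<Gamma>"
    using assms(2) by (intro image_cong) (auto simp: bounded_fm_def \<sigma>_def)
  moreover have "\<forall>n<x. subst_tm \<sigma> (case_nat (Var x) Var n) = Var n"
    by (auto simp: \<sigma>_def split: nat.split)
  then have "subst_fm \<sigma> (inst_fm (Var x) A) = subst_fm Var A"
    unfolding subst_fm_comp by (intro bounded_fmD[OF assms(3)]) simp
  ultimately show ?thesis using derives_subst[OF assms(1), of \<sigma>] by (simp add: derives.AllI)
qed

section \<open>Henkin sets\<close>

text \<open>Maximal consistent sets with witnesses. As the universal quantifier is primitive, a
  witness is a term refuting a universal formula.\<close>

locale henkin =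
  fixes H :: "fm set"
  assumes consistent: "\<not> (H \<turnstile> \<^bold>\<bottom>)"
    and complete: "A \<in> H \<or> (\<^bold>\<not> A) \<in> H"
    and witness: "(\<^bold>\<not> (\<^bold>\<forall> A)) \<in> H \<Longrightarrow> \<exists>t. (\<^bold>\<not> (inst_fm t A)) \<in> H"
begin

lemma closed: "H \<turnstile> A \<Longrightarrow> A \<in> H"
  using consistent complete Assm ImpE by metis

lemma derives_iff: "(H \<turnstile> A) \<longleftrightarrow> A \<in> H"
  using closed Assm by blast

lemma Falsity_notin: "\<^bold>\<bottom> \<notin> H"
  using consistent Assm by blast

lemma Imp_iff: "(A \<^bold>\<longrightarrow> B) \<in> H \<longleftrightarrow> (A \<in> H \<longrightarrow> B \<in> H)"
proof
  assume "(A \<^bold>\<longrightarrow> B) \<in> H"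
  then show "A \<in> H \<longrightarrow> B \<in> H" using derives_iff ImpE by metis
next
  assume *: "A \<in> H \<longrightarrow> B \<in> H"
  show "(A \<^bold>\<longrightarrow> B) \<in> H"
  proof (cases "A \<in> H")
    case True
    then have "insert A H \<turnstile> B" using * by (intro Assm) auto
    then show ?thesis by (intro closed ImpI)
  next
    case False
    then have "(\<^bold>\<not> A) \<in> H" using complete by blast
    then have "insert (\<^bold>\<not> B) (insert A H) \<turnstile> \<^bold>\<bottom>" 
      by (intro derives_contradiction[of _ A] Assm) auto
    then have "insert A H \<turnstile> B" by (rule RAA)
    then show ?thesis by (intro closed ImpI)
  qed
qed

lemma All_iff: "(\<^bold>\<forall> A) \<in> H \<longleftrightarrow> (\<forall>t. inst_fm t A \<in> H)"
  using derives_iff AllE witness complete Imp_iff Falsity_notin by metis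

lemma Eql_refl: "(t \<^bold>= t) \<in> H"
  using derives_iff EqlI by blast

lemma Eql_subst: "(s \<^bold>= t) \<in> H \<Longrightarrow> inst_fm s A \<in> H \<Longrightarrow> inst_fm t A \<in> H"
  using derives_iff EqlE by blast

text \<open>Leibniz's rule is applied to a formula where \<open>Var 0\<close> marks the place to be
  rewritten; lifted terms survive the instantiation unchanged. The congruences below follow the same
  pattern.\<close>

lemma Eql_sym: "(s \<^bold>= t) \<in> H \<Longrightarrow> (t \<^bold>= s) \<in> H"
  using Eql_subst[of s t "Var 0 \<^bold>= \<up> s"] Eql_refl by simp

lemma Eql_trans: "(s \<^bold>= t) \<in> H \<Longrightarrow> (t \<^bold>= u) \<in> H \<Longrightarrow> (s \<^bold>= u) \<in> H"
  using Eql_subst[of t u "\<up> s \<^bold>= Var 0"] by simp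

lemma Eql_Add: "(s \<^bold>= s') \<in> H \<Longrightarrow> (t \<^bold>= t') \<in> H \<Longrightarrow> (s \<^bold>+ t \<^bold>= s' \<^bold>+ t') \<in> H"
  using Eql_subst[of s s' "\<up> s \<^bold>+ \<up> t \<^bold>= Var 0 \<^bold>+ \<up> t"]
    Eql_subst[of t t' "\<up> s \<^bold>+ \<up> t \<^bold>= \<up> s' \<^bold>+ Var 0"] Eql_refl by simp

lemma Eql_Mul: "(s \<^bold>= s') \<in> H \<Longrightarrow> (t \<^bold>= t') \<in> H \<Longrightarrow> (s \<^bold>* t \<^bold>= s' \<^bold>* t') \<in> H"
  using Eql_subst[of s s' "\<up> s \<^bold>* \<up> t \<^bold>= Var 0 \<^bold>* \<up> t"]
    Eql_subst[of t t' "\<up> s \<^bold>* \<up> t \<^bold>= \<up> s' \<^bold>* Var 0"] Eql_refl by simp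

lemma Eql_Less: "(s \<^bold>= s') \<in> H \<Longrightarrow> (t \<^bold>= t') \<in> H \<Longrightarrow> (s \<^bold>< t) \<in> H \<Longrightarrow> (s' \<^bold>< t') \<in> H"
  using Eql_subst[of s s' "Var 0 \<^bold>< \<up> t"] Eql_subst[of t t' "\<up> s' \<^bold>< Var 0"] by simp

end

section \<open>Lindenbaum construction with witnesses\<close>

instance tm :: countable by countable_datatype
instance fm :: countable by countable_datatype

text \<open>The demands \<open>complete\<close> and \<open>witness\<close> for a single formula.
  Only membership in \<open>G\<close> occurs positively, so the property persists when
  \<open>G\<close> grows.\<close>

definition decides :: "fm set \<Rightarrow> fm \<Rightarrow> bool" where
  "decides G A \<longleftrightarrow> A \<in> G \<or>
    (\<^bold>\<not> A) \<in> G \<and> (\<forall>B. A = (\<^bold>\<forall> B) \<longrightarrow> (\<exists>t. (\<^bold>\<not> (inst_fm t B)) \<in> G))"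

text \<open>Finiteness leaves a fresh variable, which acts as the witness in place of a new
  constant: if adding the counterexample were inconsistent, generalising over that variable would
  prove the universal formula.\<close>

lemma consistent_extend:
  assumes F: "finite F" "\<not> (F \<turnstile> \<^bold>\<bottom>)"
  shows "\<exists>G. finite G \<and> \<not> (G \<turnstile> \<^bold>\<bottom>) \<and> F \<subseteq> G \<and> decides G A"
proof (cases "insert (\<^bold>\<not> A) F \<turnstile> \<^bold>\<bottom>")
  case True
  then have "F \<turnstile> A" by (rule RAA)
  then have ok: "\<not> (insert A F \<turnstile> \<^bold>\<bottom>)" using F(2) derives_cut by blast
  then show ?thesis using ok F(1) by (intro exI[of _ "insert A F"]) (auto simp: decides_def)
next
  case False
  let ?F = "insert (\<^bold>\<not> A) F"
  show ?thesis
  proof (cases "\<exists>B. A = (\<^bold>\<forall> B)")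
    case True
    then obtain B where B: "A = (\<^bold>\<forall> B)" by blast
    have "finite (insert B ?F)" using F(1) by simp
    then obtain x where x: "\<forall>C\<in>insert B ?F. bounded_fm x C" using bounded_fm_finite by blast
    have "\<not> (insert (\<^bold>\<not> (inst_fm (Var x) B)) ?F \<turnstile> \<^bold>\<bottom>)"
    proof
      assume "insert (\<^bold>\<not> (inst_fm (Var x) B)) ?F \<turnstile> \<^bold>\<bottom>"
      then have "?F \<turnstile> inst_fm (Var x) B" by (rule RAA)
      then have "?F \<turnstile> A" using x B derives_generalise by simp
      then show False using False derives_contradiction by blast
    qed
    then show ?thesis using F(1) B
      by (intro exI[of _ "insert (\<^bold>\<not> (inst_fm (Var x) B)) ?F"]) (auto simp: decides_def)
  next
    case no_All: False
    then show ?thesis using F(1) False by (intro exI[of _ ?F]) (auto simp: decides_def)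
  qed
qed

text \<open>Stage \<open>Suc n\<close> decides the formula with code \<open>n\<close>. The union of
  the stages is consistent because a derivation uses finitely many premises, all present at one
  stage.\<close>

lemma henkin_extension:
  assumes "finite \<Gamma>" "\<not> (\<Gamma> \<turnstile> \<^bold>\<bottom>)"
  obtains H where "\<Gamma> \<subseteq> H" "henkin H"
proof -
  let ?P = "\<lambda>(n :: nat) G. \<Gamma> \<subseteq> G \<and> finite G \<and> \<not> (G \<turnstile> \<^bold>\<bottom>)"
  let ?Q = "\<lambda>n F G. F \<subseteq> G \<and> decides G (from_nat n)"
  have base: "\<exists>G. ?P 0 G" using assms by blast
  have step: "\<exists>G. ?P (Suc n) G \<and> ?Q n F G" if F: "?P n F" for F n
  proof -
    obtain G where "finite G" "\<not> (G \<turnstile> \<^bold>\<bottom>)" "?Q n F G"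
      using F consistent_extend[of F "from_nat n"] by blast
    then show ?thesis using F by (intro exI[of _ G]) auto
  qed
  obtain F where F: "\<forall>n. ?P n (F n) \<and> ?Q n (F n) (F (Suc n))"
    using dependent_nat_choice[of ?P ?Q, OF base step] by blast
  then have P: "?P n (F n)" and Q: "?Q n (F n) (F (Suc n))" for n by simp_all
  define H where "H = (\<Union>n. F n)"
  have mono: "F m \<subseteq> F n" if "m \<le> n" for m n
    using that Q lift_Suc_mono_le[of F m n] by blast
  have "henkin H"
  proof
    show "\<not> (H \<turnstile> \<^bold>\<bottom>)"
    proof
      assume "H \<turnstile> \<^bold>\<bottom>"
      then obtain G where G: "finite G" "G \<subseteq> H" "G \<turnstile> \<^bold>\<bottom>" using derives_finite by blast
      have "\<exists>n. G \<subseteq> F n" using G(1,2)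
      proof (induction rule: finite_induct)
        case (insert A G)
        then obtain m n where "G \<subseteq> F m" "A \<in> F n" unfolding H_def by blast
        then show ?case using mono[of m "max m n"] mono[of n "max m n"]
          by (intro exI[of _ "max m n"]) auto
      qed simp
      then show False using G(3) P derives_weaken by blast
    qed
    have dec: "decides (F (Suc (to_nat A))) A" for A
      using Q[of "to_nat A"] by simp
    then show "A \<in> H \<or> (\<^bold>\<not> A) \<in> H" for A
      unfolding decides_def H_def by blast
    show "\<exists>t. (\<^bold>\<not> (inst_fm t A)) \<in> H" if neg: "(\<^bold>\<not> (\<^bold>\<forall> A)) \<in> H" for A
    proof -
      let ?n = "Suc (to_nat (\<^bold>\<forall> A))"
      \<comment> \<open>The stage \<open>?n\<close> decides the universal formula. A positive
        decision would clash with its negation at a later stage, so the decision is negative and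
        supplies a witness.\<close>
      have "(\<^bold>\<forall> A) \<notin> F ?n"
      proof
        assume pos: "(\<^bold>\<forall> A) \<in> F ?n"
        obtain k where "(\<^bold>\<not> (\<^bold>\<forall> A)) \<in> F k" using neg unfolding H_def by blast
        then have "(\<^bold>\<forall> A) \<in> F (max k ?n)" "(\<^bold>\<not> (\<^bold>\<forall> A)) \<in> F (max k ?n)"
          using pos mono[of k "max k ?n"] mono[of ?n "max k ?n"] by auto
        then have "F (max k ?n) \<turnstile> \<^bold>\<bottom>" using derives_contradiction Assm by blast
        then show False using P by blast
      qed
      then show ?thesis using dec[of "\<^bold>\<forall> A"] unfolding decides_def H_def by blast
    qed
  qed
  moreover have "\<Gamma> \<subseteq> H" using P unfolding H_def by blast
  ultimately show ?thesis using that by blast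
qed

section \<open>Infinitely many classes of provably equal terms\<close>

context henkin
begin

lemma Less_trans: "ax8 \<in> H \<Longrightarrow> (s \<^bold>< t) \<in> H \<Longrightarrow> (t \<^bold>< u) \<in> H \<Longrightarrow> (s \<^bold>< u) \<in> H"
  unfolding ax8_def Let_def numeral_eq_Suc
  by (simp (no_asm_use) add: All_iff Imp_iff Falsity_notin) blast

lemma Less_irrefl: "ax9 \<in> H \<Longrightarrow> (s \<^bold>< s) \<notin> H"
  by (simp add: ax9_def Let_def All_iff Imp_iff Falsity_notin)

lemma Less_Add_One:
  assumes "Sigma_theory \<subseteq> H"
  shows "(t \<^bold>< t \<^bold>+ One) \<in> H"
proof -
  have ax: "ax2 \<in> H" "ax6 \<in> H" "ax11 \<in> H" "ax14 \<in> H"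
    using assms by (auto simp: Sigma_theory_def)
  have comm: "(s \<^bold>+ t \<^bold>= t \<^bold>+ s) \<in> H" for s t
    using ax(1) by (simp add: ax2_def Let_def All_iff)
  have "(t \<^bold>+ Zero \<^bold>= t) \<in> H"
    using ax(2) by (simp add: ax6_def Let_def All_iff Imp_iff Falsity_notin)
  then have zero: "(Zero \<^bold>+ t \<^bold>= t) \<in> H" using comm Eql_trans by blast
  have "(Zero \<^bold>< One) \<in> H"
    using ax(4) by (simp add: ax14_def Let_def All_iff Imp_iff Falsity_notin)
  then have "(Zero \<^bold>+ t \<^bold>< One \<^bold>+ t) \<in> H"
    using ax(3) by (simp add: ax11_def Let_def All_iff Imp_iff numeral_eq_Suc)
  then show ?thesis using Eql_Less zero comm by blast
qed

text \<open>Iterated successors of zero increase strictly, and irreflexivity keeps their classes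
  apart. Infinity allows the classes to be numbered by all of \<open>nat\<close>.\<close>

lemma infinite_classes:
  assumes "Sigma_theory \<subseteq> H"
  shows "infinite (range (\<lambda>t. {s. (s \<^bold>= t) \<in> H}))"
proof -
  let ?C = "\<lambda>t. {s. (s \<^bold>= t) \<in> H}"
  have ax: "ax8 \<in> H" "ax9 \<in> H" using assms by (auto simp: Sigma_theory_def)
  \<comment> \<open>Every step adds \<open>One\<close>, so \<open>Less_Add_One\<close> applies
    uniformly; \<open>num\<close> instead passes from \<open>Zero\<close> to \<open>One\<close>
    without an addition.\<close>
  define a where "a n = ((\<lambda>t. t \<^bold>+ One) ^^ n) Zero" for n
  have less: "(a m \<^bold>< a n) \<in> H" if "m < n" for m n
    using that
  proof (induction n)
    case (Suc n)
    have "(a n \<^bold>< a (Suc n)) \<in> H" using Less_Add_One assms by (simp add: a_def)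
    then show ?case using Suc Less_trans ax(1) less_antisym by blast
  qed simp
  have neq: "?C (a m) \<noteq> ?C (a n)" if "m < n" for m n
  proof
    assume "?C (a m) = ?C (a n)"
    then have "(a n \<^bold>= a m) \<in> H" using Eql_refl Eql_sym by blast
    then show False using less[OF that] Eql_Less Eql_refl Less_irrefl ax(2) by blast
  qed
  then have "inj (\<lambda>n. ?C (a n))" by (intro linorder_injI)
  then have "infinite (range (\<lambda>n. ?C (a n)))" by (rule range_inj_infinite)
  moreover have "range (\<lambda>n. ?C (a n)) \<subseteq> range ?C" by blast
  ultimately show ?thesis using finite_subset by blast
qed

end

section \<open>The canonical structure\<close>

locale arith_structure =
  fixes zero :: 'a ("\<zero>")
    and one :: 'a ("\<one>")
    and add :: "'a \<Rightarrow> 'a \<Rightarrow> 'a" (infixl "\<oplus>" 65)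
    and mul :: "'a \<Rightarrow> 'a \<Rightarrow> 'a" (infixl "\<otimes>" 70)
    and less :: "'a \<Rightarrow> 'a \<Rightarrow> bool" (infix "\<prec>" 50)
begin

primrec eval :: "(nat \<Rightarrow> 'a) \<Rightarrow> tm \<Rightarrow> 'a" where
  "eval e (Var n) = e n"
| "eval e Zero = \<zero>"
| "eval e One = \<one>"
| "eval e (s \<^bold>+ t) = eval e s \<oplus> eval e t"
| "eval e (s \<^bold>* t) = eval e s \<otimes> eval e t"

primrec sat :: "(nat \<Rightarrow> 'a) \<Rightarrow> fm \<Rightarrow> bool" where
  "sat e \<^bold>\<bottom> \<longleftrightarrow> False"
| "sat e (s \<^bold>= t) \<longleftrightarrow> eval e s = eval e t"
| "sat e (s \<^bold>< t) \<longleftrightarrow> eval e s \<prec> eval e t"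
| "sat e (A \<^bold>\<longrightarrow> B) \<longleftrightarrow> (sat e A \<longrightarrow> sat e B)"
| "sat e (\<^bold>\<forall> A) \<longleftrightarrow> (\<forall>x. sat (case_nat x e) A)"

lemma eval_subst [simp]: "eval e (subst_tm \<sigma> t) = eval (\<lambda>n. eval e (\<sigma> n)) t"
  by (induction t) auto

text \<open>Numerals are closed terms. This moves the bounds in \<open>ax18\<close> and
  \<open>ax19\<close> out of the environments created by the quantifiers.\<close>

lemma eval_num_cong: "eval e (num k) = eval e' (num k)"
  by (induction k rule: num.induct) auto

abbreviation leq :: "'a \<Rightarrow> 'a \<Rightarrow> bool" (infix "\<preceq>" 50) where
  "x \<preceq> y \<equiv> x \<prec> y \<or> x = y"

definition divides :: "'a \<Rightarrow> 'a \<Rightarrow> bool" where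
  "divides x y \<longleftrightarrow> (\<exists>z. x \<otimes> z = y)"

definition rel_prime :: "'a \<Rightarrow> 'a \<Rightarrow> bool" where
  "rel_prime x y \<longleftrightarrow> (\<forall>d. divides d x \<and> divides d y \<longrightarrow> d = \<one>)"

definition is_prime :: "'a \<Rightarrow> bool" where
  "is_prime x \<longleftrightarrow> \<one> \<prec> x \<and> (\<forall>a b c. x \<otimes> c = a \<otimes> b \<longrightarrow> divides x a \<or> divides x b)"

definition consecutive :: "'a \<Rightarrow> 'a \<Rightarrow> bool" where
  "consecutive x y \<longleftrightarrow> x \<prec> y \<and> (\<forall>u. is_prime u \<and> x \<prec> u \<longrightarrow> y \<preceq> u)"

lemma sat_Dvd [simp]: "sat e (Dvd s t) \<longleftrightarrow> divides (eval e s) (eval e t)"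
  by (simp add: Dvd_def divides_def)

lemma sat_RelPrime [simp]: "sat e (RelPrime s t) \<longleftrightarrow> rel_prime (eval e s) (eval e t)"
  by (simp add: RelPrime_def rel_prime_def)

lemma sat_Prime [simp]: "sat e (Prime t) \<longleftrightarrow> is_prime (eval e t)"
  by (auto simp: Prime_def is_prime_def Let_def numeral_eq_Suc)

lemma sat_Consecutive [simp]:
  "sat e (Consecutive s t) \<longleftrightarrow> consecutive (eval e s) (eval e t)"
  by (auto simp: Consecutive_def consecutive_def)

end

text \<open>
  The universe is presented as the image of a map \<open>f\<close> on terms whose kernel is provable
  equality; this makes the structure normal without fixing a particular quotient type.
\<close>

locale henkin_structure = henkin H for H +
  fixes f :: "tm \<Rightarrow> 'a"
  assumes surj: "surj f"
    and kernel: "f s = f t \<longleftrightarrow> (s \<^bold>= t) \<in> H"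
begin

abbreviation rep :: "'a \<Rightarrow> tm" where "rep \<equiv> inv f"

lemma all_f: "(\<forall>x. P x) \<longleftrightarrow> (\<forall>t. P (f t))"
  using surj by (metis surjD)

lemma rep_f: "(rep (f t) \<^bold>= t) \<in> H"
  using kernel surj by (metis surj_f_inv_f)

text \<open>Operations act on the representatives chosen by \<open>inv f\<close>;
  \<open>kernel\<close> and the congruences for provable equality make the choice
  immaterial.\<close>

sublocale arith_structure "f Zero" "f One" "\<lambda>x y. f (rep x \<^bold>+ rep y)" "\<lambda>x y. f (rep x \<^bold>* rep y)"
  "\<lambda>x y. (rep x \<^bold>< rep y) \<in> H" .

lemma eval_f: "eval (\<lambda>n. f (\<sigma> n)) t = f (subst_tm \<sigma> t)"
proof (induction t)
  case (Add s t)
  then show ?case by (simp add: kernel Eql_Add rep_f)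
next
  case (Mul s t)
  then show ?case by (simp add: kernel Eql_Mul rep_f)
qed auto

text \<open>The truth lemma. It is stated for all \<open>\<sigma>\<close> because the quantifier
  case extends the substitution by an arbitrary term.\<close>

lemma sat_f: "sat (\<lambda>n. f (\<sigma> n)) A \<longleftrightarrow> subst_fm \<sigma> A \<in> H"
proof (induction A arbitrary: \<sigma>)
  case (Less s t)
  then show ?case by (auto simp: eval_f intro: Eql_Less rep_f Eql_sym)
next
  case (All A)
  have env: "case_nat (f t) (\<lambda>n. f (\<sigma> n)) = (\<lambda>n. f (case_nat t \<sigma> n))" for t
    by (auto split: nat.split)
  have "sat (\<lambda>n. f (\<sigma> n)) (\<^bold>\<forall> A) \<longleftrightarrow> (\<forall>t. sat (case_nat (f t) (\<lambda>n. f (\<sigma> n))) A)"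
    unfolding sat.simps all_f ..
  also have "\<dots> \<longleftrightarrow> subst_fm \<sigma> (\<^bold>\<forall> A) \<in> H"
    by (simp add: env All All_iff inst_subst_fm)
  finally show ?case .
qed (auto simp: Falsity_notin Imp_iff eval_f kernel)

lemma sat_iff: "sat (\<lambda>n. f (Var n)) A \<longleftrightarrow> A \<in> H"
  using sat_f[of Var] by simp

end

section \<open>Arithmetic in a model\<close>

locale sigma_model = arith_structure +
  fixes e :: "nat \<Rightarrow> 'a"
  assumes sat_Sigma: "A \<in> Sigma_theory \<Longrightarrow> sat e A"
begin

lemma add_comm: "x \<oplus> y = y \<oplus> x"
  using sat_Sigma[of ax2] by (simp add: Sigma_theory_def ax2_def Let_def)

lemma mul_assoc: "(x \<otimes> y) \<otimes> z = x \<otimes> (y \<otimes> z)"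
  using sat_Sigma[of ax3] by (simp add: Sigma_theory_def ax3_def Let_def numeral_eq_Suc)

lemma mul_comm: "x \<otimes> y = y \<otimes> x"
  using sat_Sigma[of ax4] by (simp add: Sigma_theory_def ax4_def Let_def)

lemma mul_left_comm: "x \<otimes> (y \<otimes> z) = y \<otimes> (x \<otimes> z)"
  by (metis mul_assoc mul_comm)

lemmas mul_ac = mul_assoc mul_comm mul_left_comm

lemma add_zero: "x \<oplus> \<zero> = x" and mul_zero: "x \<otimes> \<zero> = \<zero>"
  using sat_Sigma[of ax6] by (simp_all add: Sigma_theory_def ax6_def Let_def)

lemma mul_one: "x \<otimes> \<one> = x"
  using sat_Sigma[of ax7] by (simp add: Sigma_theory_def ax7_def Let_def)

lemma less_trans: "x \<prec> y \<Longrightarrow> y \<prec> z \<Longrightarrow> x \<prec> z"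
  using sat_Sigma[of ax8] 
  by (simp (no_asm_use) add: Sigma_theory_def ax8_def Let_def numeral_eq_Suc) blast

lemma less_irrefl: "\<not> x \<prec> x"
  using sat_Sigma[of ax9] by (simp add: Sigma_theory_def ax9_def Let_def)

lemma trichotomy: "x \<prec> y \<or> x = y \<or> y \<prec> x"
  using sat_Sigma[of ax10] by (auto simp add: Sigma_theory_def ax10_def Let_def)

lemma add_less: "x \<prec> y \<Longrightarrow> x \<oplus> z \<prec> y \<oplus> z"
  using sat_Sigma[of ax11] by (simp add: Sigma_theory_def ax11_def Let_def numeral_eq_Suc)

lemma mul_less: "\<zero> \<prec> z \<Longrightarrow> x \<prec> y \<Longrightarrow> x \<otimes> z \<prec> y \<otimes> z"
  using sat_Sigma[of ax12] by (simp add: Sigma_theory_def ax12_def Let_def numeral_eq_Suc)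

lemma less_diff: "x \<prec> y \<Longrightarrow> \<exists>z. x \<oplus> z = y"
  using sat_Sigma[of ax13] by (simp add: Sigma_theory_def ax13_def Let_def numeral_eq_Suc)

lemma zero_less_one: "\<zero> \<prec> \<one>" and one_le: "\<zero> \<prec> x \<Longrightarrow> \<one> \<preceq> x"
  using sat_Sigma[of ax14] by (auto simp add: Sigma_theory_def ax14_def Let_def)

lemma zero_le: "\<zero> \<prec> x \<or> x = \<zero>"
  using sat_Sigma[of ax15] by (auto simp add: Sigma_theory_def ax15_def Let_def)

lemma next_prime:
  assumes "is_prime p"
  obtains q where "is_prime q" "consecutive p q"
  using sat_Sigma[of ax16] assms
  by (auto simp add: Sigma_theory_def ax16_def Let_def consecutive_def numeral_eq_Suc)

lemma previous_prime:
  assumes "is_prime p" "\<one> \<oplus> \<one> \<prec> p"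
  obtains q where "is_prime q" "q \<prec> p" "\<And>u. is_prime u \<Longrightarrow> u \<prec> p \<Longrightarrow> u \<preceq> q"
  using sat_Sigma[of ax17] assms
  by (auto simp add: Sigma_theory_def ax17_def Let_def numeral_eq_Suc)

lemma prime_below_root:
  assumes "eval e (num 4) \<prec> n"
  obtains p where "is_prime p" "p \<otimes> p \<prec> n" "\<And>q. is_prime q \<Longrightarrow> p \<prec> q \<Longrightarrow> n \<preceq> q \<otimes> q"
proof -
  have "eval (case_nat n e) (num 4) \<prec> n" using assms eval_num_cong by metis
  then show thesis using sat_Sigma[of ax18] that
    by (auto simp add: Sigma_theory_def ax18_def Let_def numeral_2_eq_2)
qed

lemma prime_gap:
  assumes "is_prime r" "is_prime p" "is_prime q" "consecutive r p" "consecutive p q"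
    and "eval e (num 17) \<prec> q"
  shows "q \<otimes> q \<prec> (\<one> \<oplus> \<one>) \<otimes> p \<otimes> r"
proof -
  have "eval (case_nat q (case_nat p (case_nat r e))) (num 17) \<prec> q"
    using assms eval_num_cong by metis
  moreover have "num 2 = One \<^bold>+ One" by (simp add: numeral_2_eq_2)
  moreover have "sat e ax19" using sat_Sigma by (simp add: Sigma_theory_def)
  ultimately show ?thesis using assms(1-5)
    by (simp add: ax19_def Let_def numeral_2_eq_2)
qed

section \<open>Consequences for the discrete order\<close>

lemma less_asym: "x \<prec> y \<Longrightarrow> \<not> y \<preceq> x"
  using less_trans less_irrefl by metis

lemma not_less_iff: "\<not> x \<prec> y \<longleftrightarrow> y \<preceq> x"
  using trichotomy less_asym by metis

lemma less_le_trans: "x \<prec> y \<Longrightarrow> y \<preceq> z \<Longrightarrow> x \<prec> z"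
  and le_less_trans: "x \<preceq> y \<Longrightarrow> y \<prec> z \<Longrightarrow> x \<prec> z"
  using less_trans by metis+

lemma le_add: "x \<preceq> x \<oplus> y"
  using zero_le[of y] add_less[of \<zero> y x] add_comm add_zero by metis

lemma le_add_left: "y \<preceq> x \<oplus> y"
  using le_add[of y x] by (simp add: add_comm)

lemma less_add_one: "x \<prec> x \<oplus> \<one>"
  using zero_less_one add_less[of \<zero> \<one> x] add_comm add_zero by metis

lemma add_one_le: "x \<prec> y \<Longrightarrow> x \<oplus> \<one> \<preceq> y"
proof -
  assume *: "x \<prec> y"
  then obtain z where z: "x \<oplus> z = y" using less_diff by blast
  then have "z \<noteq> \<zero>" using * add_zero less_irrefl by metis
  then have "\<one> \<preceq> z" using zero_le one_le by metis
  then show ?thesis using z add_less[of \<one> z x] add_comm by metis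
qed

lemma mul_cancel: "\<zero> \<prec> z \<Longrightarrow> z \<otimes> x = z \<otimes> y \<Longrightarrow> x = y"
  using trichotomy mul_less less_irrefl mul_comm by metis

lemma square_less: "x \<prec> y \<Longrightarrow> x \<otimes> x \<prec> y \<otimes> y"
proof -
  assume *: "x \<prec> y"
  then have y: "\<zero> \<prec> y" using zero_le less_trans by metis
  have "x \<otimes> x \<preceq> x \<otimes> y"
    using * zero_le[of x] mul_less[of x x y] mul_comm mul_zero by metis
  then show ?thesis using mul_less[OF y *] le_less_trans by blast
qed

section \<open>Divisibility and primes\<close>

lemma divides_le: "divides x y \<Longrightarrow> \<zero> \<prec> y \<Longrightarrow> x \<preceq> y"
proof -
  assume "divides x y" and y: "\<zero> \<prec> y"
  then obtain z where z: "x \<otimes> z = y" unfolding divides_def by blast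
  have "\<zero> \<prec> x" using z y zero_le mul_zero mul_comm less_irrefl by metis
  moreover have "\<one> \<preceq> z" using z y zero_le one_le mul_zero less_irrefl by metis
  ultimately show ?thesis using z mul_less[of x \<one> z] mul_one mul_comm by metis
qed

lemma divides_one: "x \<otimes> y = \<one> \<Longrightarrow> x = \<one>"
  using divides_le[of x \<one>] zero_less_one one_le zero_le mul_zero mul_comm less_asym
  unfolding divides_def by metis

lemma is_primeD: "is_prime x \<Longrightarrow> x \<otimes> c = a \<otimes> b \<Longrightarrow> divides x a \<or> divides x b"
  unfolding is_prime_def by blast

lemma is_prime_gt_one: "is_prime x \<Longrightarrow> \<one> \<prec> x"
  unfolding is_prime_def by blast

lemma is_prime_pos: "is_prime x \<Longrightarrow> \<zero> \<prec> x"
  using is_prime_gt_one zero_less_one less_trans by blast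

text \<open>A prime \<open>s \<otimes> s\<close> would divide one of its factors \<open>s\<close>,
  which is smaller than it.\<close>

lemma is_prime_square: "is_prime s \<Longrightarrow> \<not> is_prime (s \<otimes> s)"
proof
  assume s: "is_prime s" and "is_prime (s \<otimes> s)"
  then have "divides (s \<otimes> s) s" using is_primeD[of "s \<otimes> s" \<one>] mul_one by metis
  then have "s \<otimes> s \<preceq> \<one> \<otimes> s" using divides_le is_prime_pos[OF s] mul_one mul_comm by metis
  moreover have "\<one> \<otimes> s \<prec> s \<otimes> s" using s is_prime_pos is_prime_gt_one mul_less by metis
  ultimately show False using less_asym by metis
qed

text \<open>Irreducibility from the Euclidean definition of primes: \<open>s\<close> must divide the
  cofactor \<open>h\<close>, and cancelling \<open>s\<close> leaves \<open>d\<close> as a divisor of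
  one.\<close>

lemma prime_factor:
  assumes s: "is_prime s" and dh: "d \<otimes> h = s" and nd: "\<not> divides s d"
  shows "d = \<one>"
proof -
  have "divides s h" using is_primeD[OF s, of \<one> d h] dh nd by (simp add: mul_one)
  then obtain g where "h = s \<otimes> g" unfolding divides_def by blast
  then have "s \<otimes> (d \<otimes> g) = s \<otimes> \<one>" using dh unfolding mul_one by (simp add: mul_ac)
  then show ?thesis using mul_cancel is_prime_pos[OF s] divides_one by blast
qed

text \<open>A common divisor \<open>d\<close> is not divisible by \<open>s\<close>, so Euclid's
  property moves \<open>s\<close> to the cofactor; cancelling it makes \<open>d\<close> a divisor of
  \<open>s\<close>, and \<open>prime_factor\<close> finishes. Neither gcds nor unique factorisation
  enter.\<close>

lemma rel_prime_square:
  assumes s: "is_prime s" and ns: "\<not> divides s m"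
  shows "rel_prime (s \<otimes> s) m"
  unfolding rel_prime_def
proof (intro allI impI)
  fix d
  assume "divides d (s \<otimes> s) \<and> divides d m"
  then obtain h k where h: "d \<otimes> h = s \<otimes> s" and k: "d \<otimes> k = m" unfolding divides_def by blast
  have nd: "\<not> divides s d" using k ns unfolding divides_def by (metis mul_assoc)
  then have "divides s h" using is_primeD[OF s, of s d h] h by simp
  then obtain g where "h = s \<otimes> g" unfolding divides_def by blast
  then have "s \<otimes> (d \<otimes> g) = s \<otimes> s" using h by (simp add: mul_ac)
  then have "d \<otimes> g = s" using mul_cancel is_prime_pos[OF s] by blast
  then show "d = \<one>" using prime_factor s nd by blast
qed

lemma prime_not_divides:
  assumes "is_prime r" "is_prime s" "r \<prec> s"
  shows "\<not> divides r s" "\<not> divides s r"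
proof -
  show "\<not> divides s r"
    using assms divides_le is_prime_pos less_asym by blast
  then show "\<not> divides r s"
    using assms prime_factor is_prime_gt_one less_irrefl unfolding divides_def by metis
qed

lemma rel_prime_comm: "rel_prime x y \<longleftrightarrow> rel_prime y x"
  unfolding rel_prime_def by blast

text \<open>
  Since \<open>m \<preceq> q\<^sup>2 \<prec> 2sr\<close>, a nonzero \<open>m\<close> divisible by \<open>s\<close> and \<open>r\<close> equals \<open>sr\<close>, which \<open>t\<close> does not divide.
\<close>

lemma three_primes:
  assumes p: "is_prime t" "is_prime r" "is_prime s" "t \<prec> r" "r \<prec> s"
    and m: "\<zero> \<prec> m" "m \<prec> (\<one> \<oplus> \<one>) \<otimes> s \<otimes> r"
  shows "\<not> (divides s m \<and> divides r m \<and> divides t m)"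
proof
  assume d: "divides s m \<and> divides r m \<and> divides t m"
  then obtain a c where a: "s \<otimes> a = m" and c: "r \<otimes> c = m" unfolding divides_def by blast
  \<comment> \<open>Euclid's property of \<open>r\<close> for the two factorisations
    \<open>r \<otimes> c = s \<otimes> a\<close>; \<open>r\<close> does not divide the larger prime
    \<open>s\<close>.\<close>
  have "divides r a" using is_primeD[OF p(2), of c s a] a c prime_not_divides(1)[OF p(2,3,5)] by simp
  then obtain k where k: "r \<otimes> k = a" unfolding divides_def by blast
  have m_eq: "m = k \<otimes> (s \<otimes> r)" using a k by (auto simp: mul_ac)
  have sr: "\<zero> \<prec> s \<otimes> r"
    using mul_less is_prime_pos[OF p(2)] is_prime_pos[OF p(3)] mul_zero mul_comm by metis
  have "k \<prec> \<one> \<oplus> \<one>"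
  proof (rule ccontr)
    assume "\<not> k \<prec> \<one> \<oplus> \<one>"
    then have "(\<one> \<oplus> \<one>) \<otimes> (s \<otimes> r) \<preceq> k \<otimes> (s \<otimes> r)"
      using not_less_iff mul_less[OF sr] by metis
    then show False using m(2) m_eq mul_assoc less_asym by metis
  qed
  then have "\<not> \<one> \<prec> k" using add_one_le less_asym by metis
  moreover have "k \<noteq> \<zero>" using m_eq m(1) mul_zero mul_comm less_irrefl by metis
  ultimately have "k = \<one>" using zero_le one_le by metis
  then have "m = s \<otimes> r" using m_eq mul_one mul_comm by metis
  then have "divides t s \<or> divides t r" using d is_primeD[OF p(1), of _ s r] unfolding divides_def by auto
  then show False
    using prime_not_divides(1) p less_trans by metis
qed

section \<open>The bound for a given prime\<close>

lemma no_good_element: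
  assumes p: "is_prime p"
  shows "\<exists>n. \<forall>m. n \<preceq> m \<longrightarrow> (\<exists>q. \<one> \<prec> q \<and> q \<prec> m \<and> rel_prime q m \<and>
    (\<forall>u. is_prime u \<and> u \<preceq> p \<longrightarrow> rel_prime u q) \<and> \<not> is_prime q)"
proof -
  \<comment> \<open>Three successors leave room for two steps down: from
    \<open>p3 \<preceq> s\<close> it will follow that \<open>p2 \<preceq> r\<close> and
    \<open>p1 \<preceq> t\<close>, hence \<open>p \<prec> t\<close>.\<close>
  obtain p1 where p1: "is_prime p1" "consecutive p p1" using next_prime p by blast
  obtain p2 where p2: "is_prime p2" "consecutive p1 p2" using next_prime p1 by blast
  obtain p3 where p3: "is_prime p3" "consecutive p2 p3" using next_prime p2 by blast
  have less: "p \<prec> p1" "p1 \<prec> p2" "p2 \<prec> p3" using p1 p2 p3 unfolding consecutive_def by auto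
  define c where "c = eval e (num 17)"
  \<comment> \<open>The summands secure, in turn, \<open>p3 \<preceq> s\<close>, the condition that
    \<open>q\<close> exceeds 17 in \<open>prime_gap\<close>, and the existence of \<open>s\<close>;
    the final \<open>\<one>\<close> makes the inequalities strict.\<close>
  define n where "n = p3 \<otimes> p3 \<oplus> c \<otimes> c \<oplus> eval e (num 4) \<oplus> \<one>"
  have top: "p3 \<otimes> p3 \<oplus> c \<otimes> c \<oplus> eval e (num 4) \<prec> n"
    unfolding n_def by (rule less_add_one)
  then have mid: "p3 \<otimes> p3 \<oplus> c \<otimes> c \<prec> n" using le_add le_less_trans by blast
  have n3: "p3 \<otimes> p3 \<prec> n" and nc: "c \<otimes> c \<prec> n" and n4: "eval e (num 4) \<prec> n"
    using top mid le_add le_add_left le_less_trans by blast+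
  show ?thesis
  proof (rule exI[of _ n], intro allI impI)
    fix m
    assume "n \<preceq> m"
    then have m3: "p3 \<otimes> p3 \<prec> m" and mc: "c \<otimes> c \<prec> m" and m4: "eval e (num 4) \<prec> m"
      using n3 nc n4 less_le_trans by blast+
    have mpos: "\<zero> \<prec> m" using m4 zero_le less_trans by metis
    obtain s where s: "is_prime s" "s \<otimes> s \<prec> m"
      and s_max: "\<And>q. is_prime q \<Longrightarrow> s \<prec> q \<Longrightarrow> m \<preceq> q \<otimes> q"
      using prime_below_root[OF m4] by blast
    \<comment> \<open>Otherwise the maximality of \<open>s\<close> would give
      \<open>m \<preceq> p3 \<otimes> p3\<close>.\<close>
    have "p3 \<preceq> s" using s_max[OF p3(1)] m3 less_asym not_less_iff by metis
    then have p2s: "p2 \<prec> s" using less less_le_trans by metis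
    have two: "\<one> \<oplus> \<one> \<preceq> x" if "is_prime x" for x
      using that is_prime_gt_one add_one_le by blast
    have "\<one> \<oplus> \<one> \<prec> s" using two[OF p2(1)] p2s le_less_trans by blast
    then obtain r where r: "is_prime r" "r \<prec> s" and r_max: "\<And>u. is_prime u \<Longrightarrow> u \<prec> s \<Longrightarrow> u \<preceq> r"
      using previous_prime s(1) by blast
    have p1r: "p1 \<prec> r" using r_max[OF p2(1) p2s] less less_le_trans by blast
    have "\<one> \<oplus> \<one> \<prec> r" using two[OF p1(1)] p1r le_less_trans by blast
    then obtain t where t: "is_prime t" "t \<prec> r" and t_max: "\<And>u. is_prime u \<Longrightarrow> u \<prec> r \<Longrightarrow> u \<preceq> t"
      using previous_prime r(1) by blast
    have pt: "p \<prec> t" using t_max[OF p1(1) p1r] less less_le_trans by blast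
    obtain q where q: "is_prime q" "consecutive s q" using next_prime s(1) by blast
    have mq: "m \<preceq> q \<otimes> q" using s_max q unfolding consecutive_def by blast
    have "c \<prec> q"
    proof (rule ccontr)
      assume "\<not> c \<prec> q"
      then have "q \<otimes> q \<preceq> c \<otimes> c" using not_less_iff square_less by metis
      then show False using mq mc less_asym less_le_trans by metis
    qed
    moreover have "consecutive r s" unfolding consecutive_def using r r_max not_less_iff less_asym
      by metis
    ultimately have "q \<otimes> q \<prec> (\<one> \<oplus> \<one>) \<otimes> s \<otimes> r" using prime_gap q r s unfolding c_def by blast
    then have "m \<prec> (\<one> \<oplus> \<one>) \<otimes> s \<otimes> r" using mq le_less_trans by blast
    then have "\<not> (divides s m \<and> divides r m \<and> divides t m)"
      using three_primes t r s mpos by blast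
    moreover have "p \<prec> r" "p \<prec> s" "r \<otimes> r \<prec> m" "t \<otimes> t \<prec> m"
      using pt t r s less_trans square_less by metis+
    \<comment> \<open>\<open>x\<close> is one of \<open>s\<close>, \<open>r\<close>,
      \<open>t\<close>; all three exceed \<open>p\<close> and have squares below
      \<open>m\<close>.\<close>
    ultimately obtain x where x: "is_prime x" "p \<prec> x" "x \<otimes> x \<prec> m" "\<not> divides x m"
      using pt t r s by metis
    have "\<one> \<prec> x \<otimes> x" using square_less is_prime_gt_one[OF x(1)] mul_one by metis
    \<comment> \<open>Here \<open>x\<close> does not divide the smaller prime \<open>u\<close>, so
      \<open>rel_prime_square\<close> applies with \<open>u\<close> in the role of
      \<open>m\<close>.\<close>
    moreover have "rel_prime u (x \<otimes> x)" if "is_prime u" "u \<preceq> p" for u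
      using that x rel_prime_square rel_prime_comm prime_not_divides(2) le_less_trans by metis
    ultimately show "\<exists>q. \<one> \<prec> q \<and> q \<prec> m \<and> rel_prime q m \<and>
        (\<forall>u. is_prime u \<and> u \<preceq> p \<longrightarrow> rel_prime u q) \<and> \<not> is_prime q"
      using x rel_prime_square is_prime_square by blast
  qed
qed

text \<open>The intermediate statement recasts \<open>no_good_element\<close> in the propositional
  shape that simplifying the satisfaction of \<open>GSw\<close> produces.\<close>

lemma sat_GSw: "sat e' GSw"
proof -
  have "\<exists>n. \<forall>m. \<not> n \<prec> m \<and> n \<noteq> m \<or> (\<exists>q. \<one> \<prec> q \<and> rel_prime q m \<and> q \<prec> m \<and>
      (\<forall>u. is_prime u \<longrightarrow> \<not> u \<prec> p \<and> u \<noteq> p \<or> rel_prime u q) \<and> \<not> is_prime q)"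
    if p: "is_prime p" for p
  proof -
    obtain n where n: "\<And>m. n \<preceq> m \<Longrightarrow> \<exists>q. \<one> \<prec> q \<and> q \<prec> m \<and> rel_prime q m \<and>
        (\<forall>u. is_prime u \<and> u \<preceq> p \<longrightarrow> rel_prime u q) \<and> \<not> is_prime q"
      using no_good_element[OF p] by blast
    have "\<not> n \<prec> m \<and> n \<noteq> m \<or> (\<exists>q. \<one> \<prec> q \<and> rel_prime q m \<and> q \<prec> m \<and>
        (\<forall>u. is_prime u \<longrightarrow> \<not> u \<prec> p \<and> u \<noteq> p \<or> rel_prime u q) \<and> \<not> is_prime q)" for m
      using n[of m] by blast
    then show ?thesis by blast
  qed
  then show ?thesis by (simp add: GSw_def Let_def numeral_eq_Suc)
qed

end

section \<open>From truth in the canonical model to derivability\<close>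

theorem theorem4p1:
  shows "Sigma_theory \<turnstile> GSw"
proof (rule RAA, rule ccontr)
  assume "\<not> (insert (\<^bold>\<not> GSw) Sigma_theory \<turnstile> \<^bold>\<bottom>)"
  then obtain H where H: "insert (\<^bold>\<not> GSw) Sigma_theory \<subseteq> H" "henkin H"
    using henkin_extension[of "insert (\<^bold>\<not> GSw) Sigma_theory"] by (auto simp: Sigma_theory_def)
  interpret henkin H by (rule H(2))
  define C where "C t = {s. (s \<^bold>= t) \<in> H}" for t
  \<comment> \<open>The classes depend on the locally obtained \<open>H\<close>, so numbers stand in
    for them: \<open>range C\<close> is countable and infinite, and its enumeration is a bijection
    onto \<open>nat\<close>.\<close>
  define f where "f = to_nat_on (range C) \<circ> C"
  have bij: "bij_betw (to_nat_on (range C)) (range C) UNIV"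
    using infinite_classes H(1) unfolding C_def by (intro to_nat_on_infinite) auto
  have C_eq: "C s = C t \<longleftrightarrow> (s \<^bold>= t) \<in> H" for s t
    unfolding C_def using Eql_refl Eql_sym Eql_trans by blast
  interpret henkin_structure H f
  proof
    show "surj f" using bij unfolding f_def bij_betw_def by (simp add: image_comp)
    show "f s = f t \<longleftrightarrow> (s \<^bold>= t) \<in> H" for s t
      using bij unfolding C_eq[symmetric] f_def bij_betw_def by (auto simp: inj_on_def)
  qed
  interpret sigma_model "f Zero" "f One" "\<lambda>x y. f (rep x \<^bold>+ rep y)" "\<lambda>x y. f (rep x \<^bold>* rep y)"
    "\<lambda>x y. (rep x \<^bold>< rep y) \<in> H" "\<lambda>n. f (Var n)"
    using H(1) by unfold_locales (auto simp: sat_iff)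
  have "GSw \<in> H" using sat_GSw sat_iff by blast
  then show False using H(1) Imp_iff Falsity_notin by auto
qed

end
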